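(* Let $D$ be a non-zero $n\times n$ generalized Euclidean distance matrix. Then $\mathrm{diag}(D)$ is majorized by $\lambda(D)$, i.e. $\mathrm{diag}(D)\prec\lambda(D)$.
   Context: All matrices are real. $\mathbf{1}\in\mathbb{R}^n$ is the vector of all ones. An $n\times n$ real symmetric matrix $L$ is a generalized Laplacian matrix if $L$ is positive semidefinite and $L\mathbf{1}=0$. An $n\times n$ matrix $D=[d_{ij}]$ is a generalized Euclidean distance matrix if there exist real numbers $a,b>0$ and an $n\times n$ generalized Laplacian matrix $L=[l_{ij}]$ such that $d_{ij}=a^2 l_{ii}+b^2 l_{jj}-2ab\,l_{ij}$ for all $i,j$; all eigenvalues of such a matrix are real. $\mathrm{diag}(D)=(d_{11},\dots,d_{nn})'$. For a matrix $A$ with only real eigenvalues, $\lambda(A)\in\mathbb{R}^n$ is the vector of eigenvalues of $A$ (with multiplicity) in decreasing order. For $x,y\in\mathbb{R}^n$, $x\prec y$ ($x$ is majorized by $y$) means $\sum_{i=1}^n x_i=\sum_{i=1}^n y_i$ and, for each $k=1,\dots,n-1$, the sum of the $k$ largest entries of $x$ is at most the sum of the $k$ largest entries of $y$. *)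

theory Defs
  imports "Jordan_Normal_Form.Char_Poly"
begin

definition generalized_laplacian :: "nat \<Rightarrow> real mat \<Rightarrow> bool" where
  "generalized_laplacian n L \<longleftrightarrow>
     L \<in> carrier_mat n n \<and>
     transpose_mat L = L \<and>
     (\<forall>v \<in> carrier_vec n. 0 \<le> v \<bullet> (L *\<^sub>v v)) \<and>
     L *\<^sub>v vec n (\<lambda>_. 1) = 0\<^sub>v n"

definition generalized_EDM :: "nat \<Rightarrow> real mat \<Rightarrow> bool" where
  "generalized_EDM n D \<longleftrightarrow>
     D \<in> carrier_mat n n \<and>
     (\<exists>a b L. 0 < a \<and> 0 < b \<and> generalized_laplacian n L \<and>
        (\<forall>i<n. \<forall>j<n.
           D $$ (i,j) = a\<^sup>2 * L $$ (i,i) + b\<^sup>2 * L $$ (j,j) - 2 * a * b * L $$ (i,j)))"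

definition diagonal_vec :: "'a mat \<Rightarrow> 'a vec" where
  "diagonal_vec A = vec_of_list (diag_mat A)"

(* The real roots of the characteristic polynomial, repeated by algebraic multiplicity and
   listed in decreasing order. This is a vector of dimension n exactly when all n complex
   eigenvalues of the n x n matrix A are real; otherwise its dimension is smaller. *)
definition eigenvalue_vec :: "real mat \<Rightarrow> real vec" where
  "eigenvalue_vec A = vec_of_list (rev (sorted_list_of_multiset (proots (char_poly A))))"

definition sum_largest :: "nat \<Rightarrow> real vec \<Rightarrow> real" where
  "sum_largest k x = sum_list (take k (rev (sort (list_of_vec x))))"

(* Vectors of different dimensions are never related. In particular a statement
   majorized x (eigenvalue_vec A) with dim_vec x = dim_row A includes that all eigenvalues
   of A are real. *)
definition majorized :: "real vec \<Rightarrow> real vec \<Rightarrow> bool" (infix "\<prec>\<^sub>m" 50) where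
  "x \<prec>\<^sub>m y \<longleftrightarrow>
     dim_vec x = dim_vec y \<and>
     (\<Sum>i<dim_vec x. x $ i) = (\<Sum>i<dim_vec y. y $ i) \<and>
     (\<forall>k. 1 \<le> k \<and> k < dim_vec x \<longrightarrow> sum_largest k x \<le> sum_largest k y)"

end

theory Submission
  imports Defs "Jordan_Normal_Form.Schur_Decomposition"
begin

text \<open>Let \<open>D\<close> be given by \<open>a\<close>, \<open>b\<close>, \<open>L\<close>, let \<open>l = diag(L)\<close> and let \<open>u\<close> be the all-ones vector. Stretching the
  direction of \<open>u\<close> by \<open>a / b\<close> turns \<open>D\<close> into the symmetric matrix
  \<open>S = a b (l u' + u l' - 2 L) + c u u'\<close> with \<open>c = (a - b)\<^sup>2 tr(L) / n\<close>. So the spectrum is real, and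
  since \<open>S\<close> is negative semidefinite on the hyperplane orthogonal to \<open>u\<close>, all eigenvalues except
  the largest are nonpositive. Hence the sum of the \<open>k \<ge> 1\<close> largest eigenvalues is at least
  \<open>tr(D)\<close>, which in turn is at least the sum of any \<open>k\<close> diagonal entries, because these are the
  nonnegative numbers \<open>(a - b)\<^sup>2 l\<^sub>i\<close>.\<close>

section \<open>Real roots and the trace\<close>

text \<open>Over the complex numbers the polynomial splits. For an eigenvector \<open>v\<close> of a
  root \<open>a\<close>, moving the real symmetric matrix across
  \<open>v \<bullet> conjugate v\<close>, which is nonzero, gives \<open>a = cnj a\<close>.\<close>

lemma real_symmetric_char_poly_splits:
  fixes S :: "real mat"
  assumes S: "S \<in> carrier_mat n n" and sym: "transpose_mat S = S"
  shows "\<exists>es. char_poly S = (\<Prod>e\<leftarrow>es. [:- e, 1:])"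
proof -
  let ?C = "map_mat complex_of_real S"
  have C: "?C \<in> carrier_mat n n" using S by simp
  obtain as where as: "char_poly ?C = (\<Prod>a\<leftarrow>as. [:- a, 1:])"
    using char_poly_factorized[OF C] by blast
  have real: "a = complex_of_real (Re a)" if "a \<in> set as" for a
  proof -
    have "poly (char_poly ?C) a = 0"
      unfolding as poly_prod_list using that by (force simp: prod_list_zero_iff)
    then have "eigenvalue ?C a" using eigenvalue_root_char_poly[OF C] by blast
    then obtain v where v: "v \<in> carrier_vec n" "v \<noteq> 0\<^sub>v n" "?C *\<^sub>v v = a \<cdot>\<^sub>v v"
      unfolding eigenvalue_def eigenvector_def using C by auto
    have cv: "conjugate v \<in> carrier_vec n" using v(1) by simp
    have Ct: "transpose_mat ?C = ?C"
      using sym by (metis map_mat_transpose)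
    have Ccv: "?C *\<^sub>v conjugate v = conjugate (?C *\<^sub>v v)"
      using S v(1) by (intro eq_vecI) (auto simp: scalar_prod_def)
    have "a * (v \<bullet> conjugate v) = (transpose_mat ?C *\<^sub>v v) \<bullet> conjugate v"
      using v cv by (simp add: Ct)
    also have "\<dots> = v \<bullet> (?C *\<^sub>v conjugate v)"
      by (rule transpose_vec_mult_scalar[OF C cv v(1)])
    also have "\<dots> = cnj a * (v \<bullet> conjugate v)"
      unfolding Ccv v(3) using v(1) cv by (simp add: conjugate_smult_vec)
    finally have "a = cnj a" using v(1,2) conjugate_square_eq_0_vec[OF v(1)] by simp
    then show ?thesis by (simp add: complex_eq_iff)
  qed
  \<comment> \<open>All roots being real, the complex factorization is the image of a real one;
    comparing coefficients pulls it back.\<close>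
  have "map_poly complex_of_real (char_poly S)
      = map_poly complex_of_real (\<Prod>e\<leftarrow>map Re as. [:- e, 1:])"
  proof -
    interpret h: map_poly_inj_idom_hom complex_of_real ..
    have "(\<Prod>a\<leftarrow>as. [:- a, 1:]) = (\<Prod>a\<leftarrow>as. map_poly complex_of_real [:- Re a, 1:])"
      using real by (intro arg_cong[of _ _ prod_list] map_cong) auto
    then show ?thesis
      by (simp add: of_real_hom.char_poly_hom[OF S, symmetric] as h.hom_prod_list o_def)
  qed
  then have "char_poly S = (\<Prod>e\<leftarrow>map Re as. [:- e, 1:])"
    by (simp add: poly_eq_iff coeff_map_poly)
  then show ?thesis by blast
qed

lemma sum_list_diag_mat: "sum_list (diag_mat A) = (\<Sum>i<dim_row A. A $$ (i,i))"
  by (simp add: diag_mat_def sum_list_distinct_conv_sum_set atLeast0LessThan)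

lemma sum_diag_mult_comm:
  fixes A B :: "'a :: comm_semiring_0 mat"
  assumes "A \<in> carrier_mat n n" "B \<in> carrier_mat n n"
  shows "sum_list (diag_mat (A * B)) = sum_list (diag_mat (B * A))"
proof -
  have "(\<Sum>i<n. \<Sum>k<n. A $$ (i,k) * B $$ (k,i)) = (\<Sum>k<n. \<Sum>i<n. B $$ (k,i) * A $$ (i,k))"
    by (subst sum.swap) (simp add: mult.commute)
  then show ?thesis
    using assms by (simp add: sum_list_diag_mat scalar_prod_def atLeast0LessThan)
qed

text \<open>Schur triangularization puts the roots on the diagonal of a similar matrix, and
  cyclicity of the trace makes the trace a similarity invariant.\<close>

lemma sum_diag_eq_sum_roots:
  fixes A :: "real mat"
  assumes A: "A \<in> carrier_mat n n" and es: "char_poly A = (\<Prod>e\<leftarrow>es. [:- e, 1:])"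
  shows "sum_list (diag_mat A) = sum_list es"
proof -
  obtain B P Q where "schur_decomposition A es = (B,P,Q)" by (metis prod_cases3)
  from schur_decomposition[OF A es this]
  have w: "similar_mat_wit A B P Q" and d: "diag_mat B = es" by auto
  note w = similar_mat_witD2[OF A w]
  have "sum_list (diag_mat (P * (B * Q))) = sum_list (diag_mat ((B * Q) * P))"
    using w by (intro sum_diag_mult_comm) auto
  also have "(B * Q) * P = B" using w by (simp add: assoc_mult_mat[of _ n n _ n _ n])
  finally show ?thesis using w d by (simp add: assoc_mult_mat[of _ n n _ n _ n])
qed

section \<open>Eigenvectors of real symmetric matrices\<close>

text \<open>The first two Schur columns span an invariant plane on which \<open>S\<close> is
  triangular with diagonal \<open>e1\<close>, \<open>e2\<close>. In an orthogonal basis of this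
  plane, symmetry removes the off-diagonal entry. A repeated root is treated like two distinct
  ones.\<close>

lemma symmetric_orthogonal_eigenvectors:
  fixes S :: "real mat"
  assumes S: "S \<in> carrier_mat n n" and sym: "transpose_mat S = S"
    and es: "char_poly S = (\<Prod>e\<leftarrow>e1 # e2 # es. [:- e, 1:])"
  obtains p q where "p \<in> carrier_vec n" "q \<in> carrier_vec n" "p \<noteq> 0\<^sub>v n" "q \<noteq> 0\<^sub>v n"
    "p \<bullet> q = 0" "S *\<^sub>v p = e1 \<cdot>\<^sub>v p" "S *\<^sub>v q = e2 \<cdot>\<^sub>v q"
proof -
  obtain B P Q where "schur_decomposition S (e1 # e2 # es) = (B,P,Q)" by (metis prod_cases3)
  from schur_decomposition[OF S es this]
  have w: "similar_mat_wit S B P Q" and tri: "upper_triangular B"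
    and d: "diag_mat B = e1 # e2 # es" by auto
  note w = similar_mat_witD2[OF S w]
  have n: "1 < n" using arg_cong[OF d, of length] w(5) by (simp add: diag_mat_def)
  have B0: "B $$ (0,0) = e1" and B1: "B $$ (1,1) = e2"
    using arg_cong[OF d, of "\<lambda>l. l ! 0"] arg_cong[OF d, of "\<lambda>l. l ! 1"] n w(5)
    by (auto simp: diag_mat_def)
  have SP: "S * P = P * B"
    using w by (simp add: assoc_mult_mat[of _ n n _ n _ n])
  define p where "p = col P 0"
  define r where "r = col P 1"
  have p: "p \<in> carrier_vec n" and r: "r \<in> carrier_vec n"
    using w n by (auto simp: p_def r_def)
  have Pu: "P *\<^sub>v unit_vec n 0 = p" "P *\<^sub>v unit_vec n 1 = r"
    using w(6) n by (auto simp: p_def r_def)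
  have c0: "col B 0 = e1 \<cdot>\<^sub>v unit_vec n 0"
    using w(5) n B0 tri by (intro eq_vecI) (auto simp: unit_vec_def upper_triangular_def)
  have c1: "col B 1 = B $$ (0,1) \<cdot>\<^sub>v unit_vec n 0 + e2 \<cdot>\<^sub>v unit_vec n 1"
    using w(5) n B1 tri by (intro eq_vecI) (auto simp: unit_vec_def upper_triangular_def)
  have Sp: "S *\<^sub>v p = e1 \<cdot>\<^sub>v p"
  proof -
    have "S *\<^sub>v p = col (S * P) 0" using col_mult2[OF S w(6), of 0] n by (simp add: p_def)
    also have "\<dots> = P *\<^sub>v col B 0" unfolding SP using col_mult2[OF w(6,5), of 0] n by simp
    finally show ?thesis unfolding c0 using w(6) n Pu by (simp add: mult_mat_vec)
  qed
  have Sr: "S *\<^sub>v r = B $$ (0,1) \<cdot>\<^sub>v p + e2 \<cdot>\<^sub>v r"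
  proof -
    have "S *\<^sub>v r = col (S * P) 1" using col_mult2[OF S w(6), of 1] n by (simp add: r_def)
    also have "\<dots> = P *\<^sub>v col B 1" unfolding SP using col_mult2[OF w(6,5), of 1] n by simp
    finally show ?thesis unfolding c1 using w(6) n Pu
      by (simp add: mult_mat_vec mult_add_distrib_mat_vec)
  qed
  have QP: "row Q i \<bullet> col P j = (if i = j then 1 else 0)" if "i < n" "j < n" for i j
    using arg_cong[OF w(2), of "\<lambda>M. M $$ (i,j)"] w(6,7) that by simp
  have p0: "p \<noteq> 0\<^sub>v n"
    using QP[of 0 0] n w(7) by (auto simp: p_def)
  then have pp: "p \<bullet> p > 0" using conjugate_square_greater_0_vec[OF p] by simp
  \<comment> \<open>Gram-Schmidt: this coefficient makes \<open>q\<close> orthogonal to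
    \<open>p\<close>.\<close>
  define x where "x = (p \<bullet> r) / (p \<bullet> p)"
  define q where "q = r - x \<cdot>\<^sub>v p"
  have q: "q \<in> carrier_vec n" using p r by (simp add: q_def)
  have pq: "p \<bullet> q = 0"
    using p r pp by (simp add: q_def scalar_prod_minus_distrib[of _ n] x_def)
  \<comment> \<open>As \<open>Q\<close> inverts \<open>P\<close>, its row 1 is dual to the columns
    of \<open>P\<close>: it annihilates \<open>p\<close> and pairs to 1 with \<open>r\<close>. This
    shows \<open>q\<close> to be nonzero.\<close>
  have "row Q 1 \<bullet> q = 1"
    using p r w(7) QP[of 1 0, folded p_def] QP[of 1 1, folded r_def] n
    by (simp add: q_def scalar_prod_minus_distrib[of _ n])
  then have q0: "q \<noteq> 0\<^sub>v n" using n w(7) by auto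
  \<comment> \<open>The off-diagonal entry of \<open>S\<close> in the basis \<open>p\<close>,
    \<open>q\<close>. Evaluating \<open>(S *\<^sub>v p) \<bullet> q\<close> in two ways shows that
    it vanishes.\<close>
  define d where "d = B $$ (0,1) + x * e2 - x * e1"
  have Sq: "S *\<^sub>v q = e2 \<cdot>\<^sub>v q + d \<cdot>\<^sub>v p"
  proof -
    have "S *\<^sub>v q = B $$ (0,1) \<cdot>\<^sub>v p + e2 \<cdot>\<^sub>v r - x \<cdot>\<^sub>v (e1 \<cdot>\<^sub>v p)"
      using S p r by (simp add: q_def mult_minus_distrib_mat_vec mult_mat_vec Sp Sr)
    then show ?thesis
      using p r by (intro eq_vecI) (auto simp: q_def d_def algebra_simps)
  qed
  have "0 = (S *\<^sub>v p) \<bullet> q" using Sp p q pq by simp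
  also have "\<dots> = p \<bullet> (S *\<^sub>v q)"
    using transpose_vec_mult_scalar[OF S q p] by (simp add: sym)
  also have "\<dots> = d * (p \<bullet> p)"
    using p q pq by (simp add: Sq scalar_prod_add_distrib[of _ n])
  finally have "d = 0" using pp by simp
  then have "S *\<^sub>v q = e2 \<cdot>\<^sub>v q" using Sq p q by auto
  with that p q p0 q0 pq Sp show thesis by blast
qed

text \<open>Courant--Fischer in codimension one.\<close>

lemma symmetric_second_root_nonpos:
  fixes S :: "real mat"
  assumes S: "S \<in> carrier_mat n n" and sym: "transpose_mat S = S"
    and es: "char_poly S = (\<Prod>e\<leftarrow>e1 # e2 # es. [:- e, 1:])" and le: "e2 \<le> e1"
    and u: "u \<in> carrier_vec n"
    and neg: "\<And>x. x \<in> carrier_vec n \<Longrightarrow> u \<bullet> x = 0 \<Longrightarrow> x \<bullet> (S *\<^sub>v x) \<le> 0"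
  shows "e2 \<le> 0"
proof (rule ccontr)
  assume "\<not> e2 \<le> 0"
  then have e: "e1 > 0" "e2 > 0" using le by auto
  obtain p q where p: "p \<in> carrier_vec n" and q: "q \<in> carrier_vec n"
    and p0: "p \<noteq> 0\<^sub>v n" and q0: "q \<noteq> 0\<^sub>v n" and pq: "p \<bullet> q = 0"
    and Sp: "S *\<^sub>v p = e1 \<cdot>\<^sub>v p" and Sq: "S *\<^sub>v q = e2 \<cdot>\<^sub>v q"
    using symmetric_orthogonal_eigenvectors[OF S sym es] by blast
  have qp: "q \<bullet> p = 0" using pq comm_scalar_prod[OF p q] by simp
  have pp: "p \<bullet> p > 0" "q \<bullet> q > 0"
    using conjugate_square_greater_0_vec[OF p] conjugate_square_greater_0_vec[OF q] p0 q0 by auto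
  have form: "(s \<cdot>\<^sub>v p + t \<cdot>\<^sub>v q) \<bullet> (S *\<^sub>v (s \<cdot>\<^sub>v p + t \<cdot>\<^sub>v q))
      = s\<^sup>2 * e1 * (p \<bullet> p) + t\<^sup>2 * e2 * (q \<bullet> q)" for s t
    using S p q pq qp
    by (simp add: mult_add_distrib_mat_vec mult_mat_vec Sp Sq scalar_prod_add_distrib[of _ n]
        add_scalar_prod_distrib[of _ n] power2_eq_square)
  have orth: "u \<bullet> (s \<cdot>\<^sub>v p + t \<cdot>\<^sub>v q) = s * (u \<bullet> p) + t * (u \<bullet> q)" for s t
    using u p q by (simp add: scalar_prod_add_distrib[of _ n])
  \<comment> \<open>The form is positive definite on the plane of \<open>p\<close> and
    \<open>q\<close>, so this plane meets the hyperplane orthogonal to \<open>u\<close> only in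
    zero.\<close>
  have zero: "s = 0 \<and> t = 0" if "s * (u \<bullet> p) + t * (u \<bullet> q) = 0" for s t
  proof -
    have "s\<^sup>2 * e1 * (p \<bullet> p) + t\<^sup>2 * e2 * (q \<bullet> q) \<le> 0"
      using neg[of "s \<cdot>\<^sub>v p + t \<cdot>\<^sub>v q"] p q that unfolding form orth by simp
    moreover have "s\<^sup>2 * e1 * (p \<bullet> p) \<ge> 0" "t\<^sup>2 * e2 * (q \<bullet> q) \<ge> 0" using e pp by auto
    ultimately have "s\<^sup>2 * e1 * (p \<bullet> p) = 0" "t\<^sup>2 * e2 * (q \<bullet> q) = 0" by linarith+
    then show ?thesis using e pp by auto
  qed
  \<comment> \<open>These coefficients always give a vector orthogonal to \<open>u\<close>. Hence
    both products vanish, and then \<open>p + q\<close> is orthogonal to \<open>u\<close> as well, a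
    contradiction.\<close>
  have "u \<bullet> q = 0" "- (u \<bullet> p) = 0"
    using zero[of "u \<bullet> q" "- (u \<bullet> p)"] by (auto simp: mult.commute)
  then show False using zero[of 1 1] by simp
qed

section \<open>Majorization by a list with nonpositive tail\<close>

text \<open>The common total separates the partial sums: cutting off nonnegative entries cannot
  raise a sum, cutting off nonpositive ones cannot lower it.\<close>

lemma majorized_if_tl_nonpos:
  fixes xs es :: "real list"
  assumes len: "length xs = length es" and sum: "sum_list xs = sum_list es"
    and nonneg: "\<And>x. x \<in> set xs \<Longrightarrow> 0 \<le> x"
    and dec: "sorted (rev es)" and nonpos: "\<And>e. e \<in> set (tl es) \<Longrightarrow> e \<le> 0"
  shows "vec_of_list xs \<prec>\<^sub>m vec_of_list es"
proof -
  have sums: "(\<Sum>i<dim_vec (vec_of_list ys). vec_of_list ys $ i) = sum_list ys" for ys :: "real list"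
    by (simp add: vec_of_list_index sum_list_sum_nth atLeast0LessThan)
  have "sum_largest k (vec_of_list xs) \<le> sum_largest k (vec_of_list es)" if "1 \<le> k" for k
  proof -
    let ?ys = "rev (sort xs)"
    have "sum_list (take k ?ys) + sum_list (drop k ?ys) = sum_list xs"
      by (metis append_take_drop_id sum_list_append sum_list_rev mset_sort sum_mset_sum_list)
    moreover have "0 \<le> sum_list (drop k ?ys)"
      by (rule sum_list_nonneg) (use nonneg in \<open>auto dest!: in_set_dropD\<close>)
    moreover have "sum_list (take k es) + sum_list (drop k es) = sum_list es"
      by (metis append_take_drop_id sum_list_append)
    moreover have "sum_list (drop k es) \<le> 0"
    proof -
      \<comment> \<open>As \<open>k \<ge> 1\<close>, the head, the only entry that may be positive,
        is never dropped.\<close>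
      have "drop k es = drop (k - 1) (tl es)" using that by (cases es; cases k) auto
      then show ?thesis using nonpos by (intro sum_list_nonpos) (auto dest: in_set_dropD)
    qed
    moreover have "rev (sort es) = es"
      using dec by (metis rev_rev_ident mset_rev properties_for_sort)
    ultimately show ?thesis using sum by (simp add: sum_largest_def list_vec)
  qed
  then show ?thesis unfolding majorized_def sums using len sum by simp
qed

section \<open>Stretching the all-ones direction\<close>

text \<open>With \<open>J = u u'\<close> this is \<open>I + g J\<close>: it scales \<open>u\<close>
  by \<open>1 + n g\<close> and fixes the orthogonal complement of \<open>u\<close>.\<close>

definition id_plus_const :: "nat \<Rightarrow> real \<Rightarrow> real mat" where
  "id_plus_const n g = mat n n (\<lambda>(i,j). (if i = j then 1 else 0) + g)"

lemma id_plus_const_carrier [simp]: "id_plus_const n g \<in> carrier_mat n n"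
  by (simp add: id_plus_const_def)

lemma index_id_plus_const_mult:
  assumes "M \<in> carrier_mat n n" "i < n" "j < n"
  shows "(id_plus_const n g * M) $$ (i,j) = M $$ (i,j) + g * (\<Sum>k<n. M $$ (k,j))"
proof -
  have "(\<Sum>k<n. ((if i = k then 1 else 0) + g) * M $$ (k,j))
      = (\<Sum>k<n. (if i = k then M $$ (k,j) else 0) + g * M $$ (k,j))"
    by (intro sum.cong) (auto simp: algebra_simps)
  then show ?thesis
    using assms
    by (simp add: id_plus_const_def scalar_prod_def atLeast0LessThan sum.distrib sum_distrib_left)
qed

lemma index_mult_id_plus_const:
  assumes "M \<in> carrier_mat n n" "i < n" "j < n"
  shows "(M * id_plus_const n g) $$ (i,j) = M $$ (i,j) + g * (\<Sum>k<n. M $$ (i,k))"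
proof -
  have "(\<Sum>k<n. M $$ (i,k) * ((if k = j then 1 else 0) + g))
      = (\<Sum>k<n. (if k = j then M $$ (i,k) else 0) + g * M $$ (i,k))"
    by (intro sum.cong) (auto simp: algebra_simps)
  then show ?thesis
    using assms
    by (simp add: id_plus_const_def scalar_prod_def atLeast0LessThan sum.distrib sum_distrib_left)
qed

text \<open>From \<open>J J = n J\<close>, the product is
  \<open>I + (g + h + n g h) J\<close>.\<close>

lemma id_plus_const_mult:
  assumes "g + h + real n * g * h = 0"
  shows "id_plus_const n g * id_plus_const n h = 1\<^sub>m n"
proof (rule eq_matI)
  fix i j assume ij: "i < dim_row (1\<^sub>m n)" "j < dim_col (1\<^sub>m n)"
  have "(\<Sum>k<n. id_plus_const n h $$ (k,j)) = 1 + real n * h"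
    using ij by (simp add: id_plus_const_def sum.distrib)
  then show "(id_plus_const n g * id_plus_const n h) $$ (i,j) = 1\<^sub>m n $$ (i,j)"
    using ij assms
    by (simp add: index_id_plus_const_mult) (simp add: id_plus_const_def algebra_simps)
qed (simp_all add: id_plus_const_def)

section \<open>Generalized Laplacians\<close>

lemma generalized_laplacian_diag_nonneg:
  assumes L: "generalized_laplacian n L" and i: "i < n"
  shows "0 \<le> L $$ (i,i)"
proof -
  have c: "L \<in> carrier_mat n n" using L by (simp add: generalized_laplacian_def)
  have "unit_vec n i \<bullet> (L *\<^sub>v unit_vec n i) = L $$ (i,i)"
    using c i by simp
  then show ?thesis using L unit_vec_carrier[of n i] unfolding generalized_laplacian_def by metis
qed

lemma generalized_laplacian_row_sum:
  assumes L: "generalized_laplacian n L" and i: "i < n"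
  shows "(\<Sum>j<n. L $$ (i,j)) = 0"
proof -
  have c: "L \<in> carrier_mat n n" using L by (simp add: generalized_laplacian_def)
  have "(L *\<^sub>v vec n (\<lambda>_. 1)) $ i = 0" using L i by (simp add: generalized_laplacian_def)
  then show ?thesis using c i by (simp add: scalar_prod_def atLeast0LessThan)
qed

lemma generalized_laplacian_sym:
  assumes L: "generalized_laplacian n L" and "i < n" "j < n"
  shows "L $$ (i,j) = L $$ (j,i)"
proof -
  have "L \<in> carrier_mat n n" "transpose_mat L = L"
    using L by (simp_all add: generalized_laplacian_def)
  then show ?thesis using assms(2,3) by (metis carrier_matD index_transpose_mat(1))
qed

lemma scalar_prod_mult_mat_vec:
  assumes "A \<in> carrier_mat n n" "x \<in> carrier_vec n"
  shows "x \<bullet> (A *\<^sub>v x) = (\<Sum>i<n. \<Sum>j<n. x $ i * A $$ (i,j) * x $ j)"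
  using assms by (simp add: scalar_prod_def atLeast0LessThan sum_distrib_left mult.assoc)

section \<open>Symmetrization of \<open>D\<close>\<close>

text \<open>\<open>D = a\<^sup>2 l u' + b\<^sup>2 u l' - 2 a b L\<close> need not be symmetric.
  Since \<open>L\<close> annihilates \<open>u\<close>, conjugation by \<open>I + g J\<close>
  preserves the \<open>L\<close> part, while a suitable \<open>g\<close> brings both outer weights
  to \<open>a b\<close>; what remains is a multiple of \<open>J\<close>.\<close>

lemma generalized_EDM_similar_symmetric:
  assumes D: "generalized_EDM n D" and n: "0 < n"
  obtains S where "S \<in> carrier_mat n n" "transpose_mat S = S" "similar_mat D S"
    "\<And>x. x \<in> carrier_vec n \<Longrightarrow> vec n (\<lambda>_. 1) \<bullet> x = 0 \<Longrightarrow> x \<bullet> (S *\<^sub>v x) \<le> 0"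
proof -
  from D obtain a b L where Dc: "D \<in> carrier_mat n n" and ab: "0 < a" "0 < b"
    and L: "generalized_laplacian n L"
    and Dij: "\<And>i j. i < n \<Longrightarrow> j < n \<Longrightarrow>
      D $$ (i,j) = a\<^sup>2 * L $$ (i,i) + b\<^sup>2 * L $$ (j,j) - 2 * a * b * L $$ (i,j)"
    unfolding generalized_EDM_def by blast
  have Lc: "L \<in> carrier_mat n n" using L by (simp add: generalized_laplacian_def)
  note rows = generalized_laplacian_row_sum[OF L]
  have cols: "(\<Sum>i<n. L $$ (i,j)) = 0" if "j < n" for j
    using rows[OF that] generalized_laplacian_sym[OF L _ that] by simp
  define t where "t = (\<Sum>i<n. L $$ (i,i))"
  \<comment> \<open>Similarity forces this value: all diagonal entries of \<open>S\<close> equal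
    \<open>c\<close>, and \<open>n c\<close> must be the trace \<open>(a - b)\<^sup>2 t\<close> of
    \<open>D\<close>.\<close>
  define c where "c = (a - b)\<^sup>2 * t / n"
  define S where
    "S = mat n n (\<lambda>(i,j). a * b * (L $$ (i,i) + L $$ (j,j) - 2 * L $$ (i,j)) + c)"
  have Sc: "S \<in> carrier_mat n n" by (simp add: S_def)
  have sym: "transpose_mat S = S"
    by (intro eq_matI) (auto simp: S_def generalized_laplacian_sym[OF L])
  \<comment> \<open>The stretching factor \<open>a / b\<close> equalizes the two off-diagonal blocks of \<open>D\<close> with respect to the
    splitting into the all-ones direction and its orthogonal complement.\<close>
  define g where "g = (a / b - 1) / n"
  define h where "h = (b / a - 1) / n"
  \<comment> \<open>Equivalent to \<open>(1 + n g) (1 + n h) = 1\<close>, the factors being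
    \<open>a / b\<close> and \<open>b / a\<close>.\<close>
  have gh: "g + h + real n * g * h = 0" using ab n by (simp add: g_def h_def field_simps)
  let ?P = "id_plus_const n g" and ?Q = "id_plus_const n h"
  have PQ: "?P * ?Q = 1\<^sub>m n" using gh by (rule id_plus_const_mult)
  have QP: "?Q * ?P = 1\<^sub>m n" using gh by (intro id_plus_const_mult) (simp add: algebra_simps)
  \<comment> \<open>Equality of the terms free of \<open>i\<close> and \<open>j\<close> in
    \<open>?P * D = S * ?P\<close>.\<close>
  have gt: "g * a\<^sup>2 * t = c + g * (a * b * t + real n * c)"
    using ab n by (simp add: g_def c_def field_simps power2_eq_square)
  have gb: "g * b * real n = a - b"
    using ab n by (simp add: g_def field_simps)
  have PD: "?P * D = S * ?P"
  proof (rule eq_matI)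
    fix i j assume "i < dim_row (S * ?P)" "j < dim_col (S * ?P)"
    then have ij: "i < n" "j < n" using Sc by (auto simp: id_plus_const_def)
    have "(\<Sum>k<n. D $$ (k,j)) = a\<^sup>2 * t + real n * b\<^sup>2 * L $$ (j,j)"
      using ij cols
      by (simp add: Dij sum.distrib sum_subtractf t_def flip: sum_distrib_left)
    then have 1: "(?P * D) $$ (i,j) = D $$ (i,j) + g * (a\<^sup>2 * t + real n * b\<^sup>2 * L $$ (j,j))"
      using index_id_plus_const_mult[OF Dc ij] by simp
    have "(\<Sum>k<n. S $$ (i,k)) = a * b * (real n * L $$ (i,i) + t) + real n * c"
      using ij rows
      by (simp add: S_def sum.distrib sum_subtractf t_def flip: sum_distrib_left)
    then have 2: "(S * ?P) $$ (i,j)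
        = S $$ (i,j) + g * (a * b * (real n * L $$ (i,i) + t) + real n * c)"
      using index_mult_id_plus_const[OF Sc ij] by simp
    \<comment> \<open>The weights now agree on both sides:
      \<open>b\<^sup>2 + (a - b) b = a b\<close> at \<open>L $$ (j,j)\<close>, and
      \<open>a b + (a - b) a = a\<^sup>2\<close> at \<open>L $$ (i,i)\<close>.\<close>
    have "g * (real n * b\<^sup>2 * L $$ (j,j)) = (a - b) * b * L $$ (j,j)"
      "g * (a * b * (real n * L $$ (i,i))) = (a - b) * a * L $$ (i,i)"
      unfolding gb[symmetric] by (simp_all add: power2_eq_square)
    then show "(?P * D) $$ (i,j) = (S * ?P) $$ (i,j)"
      unfolding 1 2 using gt ij
      by (simp add: Dij S_def algebra_simps power2_eq_square)
  qed (use Sc Dc in \<open>simp_all add: id_plus_const_def\<close>)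
  have "?Q * S * ?P = ?Q * (S * ?P)"
    using Sc by (simp add: assoc_mult_mat[of _ n n _ n _ n])
  also have "\<dots> = (?Q * ?P) * D"
    unfolding PD[symmetric] using Dc by (simp add: assoc_mult_mat[of _ n n _ n _ n])
  also have "\<dots> = D" unfolding QP using Dc by simp
  finally have sim: "similar_mat D S"
    using Dc Sc PQ QP by (intro similar_matI[of D S ?Q ?P n]) auto
  have "x \<bullet> (S *\<^sub>v x) \<le> 0" if x: "x \<in> carrier_vec n" and x0: "vec n (\<lambda>_. 1) \<bullet> x = 0" for x
  proof -
    have x0: "(\<Sum>i<n. x $ i) = 0" using x x0 by (simp add: scalar_prod_def atLeast0LessThan)
    \<comment> \<open>The first summand contains the coordinate sum of \<open>x\<close>, the second
      acquires it after summation over \<open>i\<close>; only the \<open>L\<close> part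
      survives.\<close>
    have "(\<Sum>j<n. x $ i * S $$ (i,j) * x $ j)
      = (a * b * L $$ (i,i) + c) * x $ i * (\<Sum>j<n. x $ j)
        + a * b * x $ i * (\<Sum>j<n. L $$ (j,j) * x $ j)
        - 2 * a * b * (\<Sum>j<n. x $ i * L $$ (i,j) * x $ j)" if "i < n" for i
      unfolding sum_distrib_left sum.distrib[symmetric] sum_subtractf[symmetric]
      using that by (intro sum.cong) (auto simp: S_def algebra_simps)
    then have "x \<bullet> (S *\<^sub>v x) = (\<Sum>i<n. a * b * (\<Sum>j<n. L $$ (j,j) * x $ j) * x $ i
        - 2 * a * b * (\<Sum>j<n. x $ i * L $$ (i,j) * x $ j))"
      unfolding scalar_prod_mult_mat_vec[OF Sc x] x0
      by (intro sum.cong) (auto simp: algebra_simps)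
    also have "\<dots> = - 2 * a * b * (x \<bullet> (L *\<^sub>v x))"
      unfolding sum_subtractf sum_distrib_left[symmetric] x0 scalar_prod_mult_mat_vec[OF Lc x]
      by simp
    also have "\<dots> \<le> 0" using ab L x by (simp add: generalized_laplacian_def)
    finally show ?thesis .
  qed
  with that Sc sym sim show thesis by blast
qed

section \<open>Spectrum and diagonal of \<open>D\<close>\<close>

theorem theorem2p20:
  fixes n :: nat and D :: "real mat"
  assumes "generalized_EDM n D"
    and "D \<noteq> 0\<^sub>m n n"
  shows "diagonal_vec D \<prec>\<^sub>m eigenvalue_vec D"
proof -
  have D: "D \<in> carrier_mat n n" using assms(1) by (simp add: generalized_EDM_def)
  \<comment> \<open>The only matrix of size 0 is the zero matrix. The symmetrization divides by
    \<open>n\<close>.\<close>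
  have n: "0 < n" using assms(2) D by (cases n) auto
  obtain S where S: "S \<in> carrier_mat n n" "transpose_mat S = S" and sim: "similar_mat D S"
    and neg: "\<And>x. x \<in> carrier_vec n \<Longrightarrow> vec n (\<lambda>_. 1) \<bullet> x = 0 \<Longrightarrow> x \<bullet> (S *\<^sub>v x) \<le> 0"
    using generalized_EDM_similar_symmetric[OF assms(1) n] by blast
  have DS: "char_poly D = char_poly S" using char_poly_similar[OF sim] .
  obtain fs where fs: "char_poly D = (\<Prod>e\<leftarrow>fs. [:- e, 1:])"
    using real_symmetric_char_poly_splits[OF S] DS by auto
  define es where "es = rev (sorted_list_of_multiset (proots (char_poly D)))"
  \<comment> \<open>Because the polynomial splits over the reals, \<open>proots\<close> returns all
    \<open>n\<close> eigenvalues, and the sorted list \<open>es\<close> gives the same factorization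
    as \<open>fs\<close>.\<close>
  have "proots (char_poly D) = mset fs"
  proof -
    have nonzero: "(\<Prod>e\<leftarrow>gs. [:- e, 1:]) \<noteq> 0" for gs :: "real list"
      by (auto simp: prod_list_zero_iff)
    show ?thesis
      unfolding fs by (induction fs) (simp_all add: proots_mult[OF _ nonzero] del: mult_pCons_left)
  qed
  then have "mset es = mset fs" by (simp add: es_def)
  then have es: "char_poly D = (\<Prod>e\<leftarrow>es. [:- e, 1:])"
    unfolding fs by (metis mset_map prod_mset_prod_list)
  have dec: "sorted (rev es)" by (simp add: es_def)
  have len: "length (diag_mat D) = length es"
    using degree_monic_char_poly[OF D] D
    by (simp add: es degree_linear_factors diag_mat_def)
  have nonpos: "e \<le> 0" if e: "e \<in> set (tl es)" for e
  proof -
    \<comment> \<open>A nonempty tail provides a second root, which bounds the whole tail since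
      \<open>es\<close> is decreasing.\<close>
    obtain e1 e2 rest where eq: "es = e1 # e2 # rest"
      using e by (cases es; cases "tl es") auto
    have "e2 \<le> e1" "e \<le> e2" using dec e unfolding eq by (auto simp: sorted_append)
    moreover have "e2 \<le> 0"
      using symmetric_second_root_nonpos[OF S es[unfolded DS eq] \<open>e2 \<le> e1\<close> vec_carrier neg] .
    ultimately show ?thesis by simp
  qed
  have nonneg: "0 \<le> x" if x: "x \<in> set (diag_mat D)" for x
  proof -
    obtain i where i: "i < n" "x = D $$ (i,i)" using x D by (auto simp: diag_mat_def)
    obtain a b L where L: "generalized_laplacian n L"
      and "D $$ (i,i) = a\<^sup>2 * L $$ (i,i) + b\<^sup>2 * L $$ (i,i) - 2 * a * b * L $$ (i,i)"
      using assms(1) i(1) unfolding generalized_EDM_def by blast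
    then have "x = (a - b)\<^sup>2 * L $$ (i,i)" using i by (simp add: power2_diff algebra_simps)
    then show ?thesis using generalized_laplacian_diag_nonneg[OF L i(1)] by simp
  qed
  show ?thesis
    unfolding diagonal_vec_def eigenvalue_vec_def es_def[symmetric]
    using majorized_if_tl_nonpos[OF len sum_diag_eq_sum_roots[OF D es] nonneg dec nonpos] .
qed

end
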